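(* Let $n\geq 3$ be an integer, let $P_n$ be the path with $n$ vertices and let $C_n$ be the cycle with $n$ vertices. Then $$\gamma_{plsR}(P_n)=\left\lfloor\frac{2n}{3}\right\rfloor\quad\text{and}\quad \gamma_{plsR}(C_n)=\left\lceil\frac{2n}{3}\right\rceil.$$
   Context: All graphs are finite, without loops or parallel edges. For a graph $G=(V,E)$ and $v\in V$, $N[v]=\{v\}\cup\{u : uv\in E\}$ is the closed neighborhood. A perfect locating signed Roman dominating (PLSRD) function on $G=(V,E)$ is a function $f: V\to\{-1,1,2\}$ such that: (C1) each vertex $v$ with $f(v)=-1$ is adjacent to exactly one vertex $u$ with $f(u)=2$; (C2) distinct vertices $v,w$ with $f(v)=f(w)=-1$ have no common neighbor $u$ with $f(u)=2$; (C3) for every vertex $v$, $\sum_{u\in N[v]} f(u)\geq 1$. The weight of $f$ is $f(V)=\sum_{v\in V} f(v)$. The perfect locating signed Roman domination number $\gamma_{plsR}(G)$ is the minimum weight over all PLSRD functions on $G$. *)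

theory Defs
  imports Complex_Main
begin

type_synonym 'a ugraph = "'a set \<times> 'a set set"

abbreviation verts :: "'a ugraph \<Rightarrow> 'a set" where
  "verts G \<equiv> fst G"

abbreviation edges :: "'a ugraph \<Rightarrow> 'a set set" where
  "edges G \<equiv> snd G"

definition simple_graph :: "'a ugraph \<Rightarrow> bool" where
  "simple_graph G \<longleftrightarrow> finite (verts G) \<and> (\<forall>e\<in>edges G. e \<subseteq> verts G \<and> card e = 2)"

definition adj :: "'a ugraph \<Rightarrow> 'a \<Rightarrow> 'a \<Rightarrow> bool" where
  "adj G u v \<longleftrightarrow> {u, v} \<in> edges G"

definition closed_nbhd :: "'a ugraph \<Rightarrow> 'a \<Rightarrow> 'a set" where
  "closed_nbhd G v = {v} \<union> {u \<in> verts G. adj G u v}"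

text \<open>Only the values of \<open>f\<close> on the vertices matter; functions on the vertex set are
  represented by total functions with unconstrained values elsewhere.\<close>

definition plsrd_function :: "'a ugraph \<Rightarrow> ('a \<Rightarrow> int) \<Rightarrow> bool" where
  "plsrd_function G f \<longleftrightarrow>
     (\<forall>v\<in>verts G. f v \<in> {-1, 1, 2}) \<and>
     (\<forall>v\<in>verts G. f v = -1 \<longrightarrow> (\<exists>!u. u \<in> verts G \<and> adj G v u \<and> f u = 2)) \<and>
     (\<forall>v\<in>verts G. \<forall>w\<in>verts G. v \<noteq> w \<and> f v = -1 \<and> f w = -1 \<longrightarrow>
        \<not> (\<exists>u\<in>verts G. adj G v u \<and> adj G w u \<and> f u = 2)) \<and>
     (\<forall>v\<in>verts G. (\<Sum>u\<in>closed_nbhd G v. f u) \<ge> 1)"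

definition weight :: "'a ugraph \<Rightarrow> ('a \<Rightarrow> int) \<Rightarrow> int" where
  "weight G f = (\<Sum>v\<in>verts G. f v)"

definition plsrd_number :: "'a ugraph \<Rightarrow> int" where
  "plsrd_number G = Min {weight G f | f. plsrd_function G f}"

text \<open>The set of weights is finite and nonempty for every simple graph, so the minimum is
  attained.\<close>

lemma finite_plsrd_weights:
  assumes "simple_graph G"
  shows "finite {weight G f | f. plsrd_function G f}"
proof (rule finite_subset)
  let ?n = "int (card (verts G))"
  show "{weight G f | f. plsrd_function G f} \<subseteq> {- ?n .. 2 * ?n}"
  proof clarify
    fix f :: "'a \<Rightarrow> int" assume "plsrd_function G f"
    then have *: "f v \<in> {-1, 1, 2}" if "v \<in> verts G" for v
      using that unfolding plsrd_function_def by blast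
    have "(\<Sum>v\<in>verts G. -1) \<le> weight G f" "weight G f \<le> (\<Sum>v\<in>verts G. 2)"
      unfolding weight_def by (rule sum_mono, use * in force)+
    then show "weight G f \<in> {- ?n .. 2 * ?n}" by simp
  qed
qed simp

lemma plsrd_weights_nonempty:
  assumes "simple_graph G"
  shows "{weight G f | f. plsrd_function G f} \<noteq> {}"
proof -
  have "finite (closed_nbhd G v)" for v
    using assms by (auto simp: simple_graph_def closed_nbhd_def)
  moreover have "v \<in> closed_nbhd G v" for v
    by (simp add: closed_nbhd_def)
  ultimately have "card (closed_nbhd G v) > 0" for v
    by (metis card_gt_0_iff empty_iff)
  then have "(\<Sum>u\<in>closed_nbhd G v. 1) \<ge> (1::int)" for v
    by (simp add: Suc_le_eq)
  then have "plsrd_function G (\<lambda>_. 1)"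
    by (simp add: plsrd_function_def)
  then show ?thesis by blast
qed

definition path_graph :: "nat \<Rightarrow> nat ugraph" where
  "path_graph n = ({..<n}, {{i, i + 1} | i. i + 1 < n})"

text \<open>This is a simple graph, namely the cycle of length \<open>n\<close>, only for \<open>n \<ge> 3\<close>.\<close>

definition cycle_graph :: "nat \<Rightarrow> nat ugraph" where
  "cycle_graph n = ({..<n}, {{i, (i + 1) mod n} | i. i < n})"

lemma simple_graph_path_graph: "simple_graph (path_graph n)"
  by (auto simp: simple_graph_def path_graph_def)

lemma simple_graph_cycle_graph: "n \<ge> 3 \<Longrightarrow> simple_graph (cycle_graph n)"
  by (auto simp: simple_graph_def cycle_graph_def card_insert_if mod_Suc)

end

theory Submission
  imports Defs
begin

text \<open>Write \<open>M\<close> for the set of vertices of value \<open>-1\<close>. Sending each of them to its neighbor of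
  value \<open>2\<close> is injective, so a PLSRD function on \<open>n\<close> vertices has weight at least \<open>n - |M|\<close>. If
  all closed neighborhoods have at most three elements, (C3) allows at most one vertex of \<open>M\<close> in
  each, and double counting gives that the closed neighborhoods of the vertices of \<open>M\<close> have total
  size at most \<open>n\<close>: thus \<open>3 |M| \<le> n\<close> on a cycle, and \<open>3 |M| \<le> n + 2\<close> on a path because only
  the two ends have a smaller neighborhood. The pattern \<open>-1, 2, 1\<close>, repeated and adjusted at
  the end, attains both bounds.\<close>

section \<open>Estimates for general simple graphs\<close>

lemma adj_commute: "adj G u v \<longleftrightarrow> adj G v u"
  by (simp add: adj_def insert_commute)

lemma finite_closed_nbhd: "simple_graph G \<Longrightarrow> finite (closed_nbhd G v)"
  by (simp add: closed_nbhd_def simple_graph_def)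

lemma plsrd_weight_ge:
  assumes G: "simple_graph G" and f: "plsrd_function G f"
  shows "weight G f \<ge> int (card (verts G)) - int (card {v \<in> verts G. f v = -1})"
proof -
  let ?V = "verts G" and ?M = "{v \<in> verts G. f v = -1}" and ?T = "{v \<in> verts G. f v = 2}"
  have fin: "finite ?V" "finite ?T"
    using G by (simp_all add: simple_graph_def)
  have vals: "f v \<in> {-1, 1, 2}" if "v \<in> ?V" for v
    using f that unfolding plsrd_function_def by blast
  have "\<forall>v\<in>?M. \<exists>u. u \<in> ?T \<and> adj G v u"
    using f unfolding plsrd_function_def by blast
  then obtain g where g: "\<forall>v\<in>?M. g v \<in> ?T \<and> adj G v (g v)"
    using bchoice[of ?M "\<lambda>v u. u \<in> ?T \<and> adj G v u"] by blast
  have "inj_on g ?M"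
  proof (rule inj_onI, rule ccontr)
    fix v w assume "v \<in> ?M" "w \<in> ?M" "g v = g w" "v \<noteq> w"
    then have "g v \<in> ?T \<and> adj G v (g v) \<and> adj G w (g v)"
      using g[rule_format, of v] g[rule_format, of w] by simp
    then show False
      using f \<open>v \<in> ?M\<close> \<open>w \<in> ?M\<close> \<open>v \<noteq> w\<close> unfolding plsrd_function_def by blast
  qed
  then have "card ?M \<le> card ?T"
    using g fin by (intro card_inj_on_le[of g]) blast+
  \<comment> \<open>Each of -1, 1, 2 is 1 corrected by -2 or +1, so the weight is |V| - 2|M| + |T|,
    and |M| \<le> |T| finishes.\<close>
  moreover have "weight G f = (\<Sum>v\<in>?V. 1 - 2 * of_bool (f v = -1) + of_bool (f v = 2))"
    unfolding weight_def
  proof (rule sum.cong)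
    fix v assume "v \<in> ?V"
    then show "f v = 1 - 2 * of_bool (f v = -1) + of_bool (f v = 2)"
      using vals[of v] by auto
  qed simp
  moreover have "\<dots> = int (card ?V) - 2 * int (card ?M) + int (card ?T)"
    using fin by (simp add: sum.distrib sum_subtractf sum_of_bool_eq Int_def flip: sum_distrib_left)
  ultimately show ?thesis
    by linarith
qed

text \<open>With |A| \<ge> 2 values -1 among |N| \<le> 3 and all others at most 2, the sum is at
  most 2|N| - 3|A| \<le> 0, against (C3).\<close>

lemma plsrd_card_minus_in_closed_nbhd:
  assumes G: "simple_graph G" and f: "plsrd_function G f" and v: "v \<in> verts G"
    and deg: "card (closed_nbhd G v) \<le> 3"
  shows "card {u \<in> closed_nbhd G v. f u = -1} \<le> 1"
proof (rule ccontr)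
  let ?N = "closed_nbhd G v" and ?A = "{u \<in> closed_nbhd G v. f u = -1}"
  assume "\<not> card ?A \<le> 1"
  then have A: "card ?A \<ge> 2" by simp
  have fin: "finite ?N"
    using G by (rule finite_closed_nbhd)
  have N: "?N \<subseteq> verts G"
    using v by (auto simp: closed_nbhd_def)
  have "sum f ?N = sum f ?A + sum f (?N - ?A)"
    using fin by (subst sum.subset_diff[of ?A ?N]) auto
  also have "sum f ?A = - int (card ?A)"
    by simp
  also have "sum f (?N - ?A) \<le> (\<Sum>u\<in>?N - ?A. 2)"
    using f N unfolding plsrd_function_def by (intro sum_mono) force
  also have "\<dots> = 2 * (int (card ?N) - int (card ?A))"
    using fin by (simp add: card_Diff_subset card_mono of_nat_diff)
  finally have "sum f ?N \<le> 0"
    using A deg by simp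
  moreover have "sum f ?N \<ge> 1"
    using f v unfolding plsrd_function_def by blast
  ultimately show False by simp
qed

lemma plsrd_sum_card_closed_nbhd_le:
  assumes G: "simple_graph G" and f: "plsrd_function G f"
    and deg: "\<And>v. v \<in> verts G \<Longrightarrow> card (closed_nbhd G v) \<le> 3"
  shows "(\<Sum>u | u \<in> verts G \<and> f u = -1. card (closed_nbhd G u)) \<le> card (verts G)"
proof -
  let ?V = "verts G" and ?M = "{v \<in> verts G. f v = -1}"
  have fin: "finite ?V"
    using G by (simp add: simple_graph_def)
  \<comment> \<open>By symmetry of adjacency, the closed neighborhood of \<open>u\<close> consists
    of the \<open>v\<close> whose closed neighborhood contains \<open>u\<close>; this prepares the
    exchange of summation.\<close>
  have "(\<Sum>u\<in>?M. card (closed_nbhd G u)) = (\<Sum>u\<in>?M. card {v \<in> ?V. u \<in> closed_nbhd G v})"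
    by (intro sum.cong refl arg_cong[of _ _ card])
      (auto simp: closed_nbhd_def adj_commute[of G])
  also have "\<dots> = (\<Sum>v\<in>?V. card {u \<in> ?M. u \<in> closed_nbhd G v})"
    using fin by (intro sum_multicount_gen) auto
  also have "\<dots> \<le> (\<Sum>v\<in>?V. 1)"
  proof (rule sum_mono)
    fix v assume v: "v \<in> ?V"
    then have "{u \<in> ?M. u \<in> closed_nbhd G v} = {u \<in> closed_nbhd G v. f u = -1}"
      by (auto simp: closed_nbhd_def)
    then show "card {u \<in> ?M. u \<in> closed_nbhd G v} \<le> 1"
      using plsrd_card_minus_in_closed_nbhd[OF G f v deg[OF v]] by simp
  qed
  finally show ?thesis by simp
qed

lemma nat_mod_3_cases:
  fixes i :: nat
  obtains k where "i = 3 * k" | k where "i = 3 * k + 1" | k where "i = 3 * k + 2"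
  by atomize_elim presburger

lemma plsrd_number_eqI:
  assumes "simple_graph G" "plsrd_function G f" "weight G f = w"
    and "\<And>g. plsrd_function G g \<Longrightarrow> w \<le> weight G g"
  shows "plsrd_number G = w"
  unfolding plsrd_number_def
  using assms by (intro Min_eqI finite_plsrd_weights) auto

subsection \<open>Paths\<close>

lemma verts_path_graph [simp]: "verts (path_graph n) = {..<n}"
  by (simp add: path_graph_def)

lemma adj_path_graph: "adj (path_graph n) u v \<longleftrightarrow> u < n \<and> v < n \<and> (v = u + 1 \<or> u = v + 1)"
  by (auto simp: adj_def path_graph_def doubleton_eq_iff)

lemma closed_nbhd_path_graph:
  assumes "n \<ge> 2" "v < n"
  shows "closed_nbhd (path_graph n) v =
    (if v = 0 then {0, 1} else if v = n - 1 then {n - 2, n - 1} else {v - 1, v, v + 1})"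
  using assms by (auto simp: closed_nbhd_def adj_path_graph)

lemma plsrd_path_graph_weight_ge:
  assumes n: "n \<ge> 3" and f: "plsrd_function (path_graph n) f"
  shows "weight (path_graph n) f \<ge> 2 * int n div 3"
proof -
  let ?M = "{v \<in> verts (path_graph n). f v = -1}"
  have "(\<Sum>u\<in>?M. card (closed_nbhd (path_graph n) u)) \<le> n"
    using plsrd_sum_card_closed_nbhd_le[OF simple_graph_path_graph f] n
    by (simp add: closed_nbhd_path_graph card_insert_if)
  \<comment> \<open>The extra term makes up for the two ends, whose closed neighborhoods have only
    two elements.\<close>
  moreover have "(\<Sum>u\<in>?M. 3) \<le>
      (\<Sum>u\<in>?M. card (closed_nbhd (path_graph n) u) + of_bool (u \<in> {0, n - 1}))"
    using n by (intro sum_mono) (auto simp: closed_nbhd_path_graph card_insert_if)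
  moreover have "(\<Sum>u\<in>?M. of_bool (u \<in> {0, n - 1})) \<le> (2::nat)"
  proof -
    have "(\<Sum>u\<in>?M. of_bool (u \<in> {0, n - 1}) :: nat) = card (?M \<inter> {0, n - 1})"
      by (simp add: of_bool_def sum.If_cases Int_def)
    also have "\<dots> \<le> card {0, n - 1}"
      by (intro card_mono) auto
    also have "\<dots> \<le> 2"
      by (simp add: card_insert_if)
    finally show ?thesis .
  qed
  ultimately have "3 * card ?M \<le> n + 2"
    by (simp add: sum.distrib)
  \<comment> \<open>n minus the floor of (n + 2)/3 is the floor of 2n/3.\<close>
  then show ?thesis
    using plsrd_weight_ge[OF simple_graph_path_graph f] by simp
qed

text \<open>The disjunct \<open>i + 2 = n\<close> matters only for \<open>n mod 3 = 1\<close>, where the last vertex has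
  value \<open>-1\<close> and needs a neighbor of value \<open>2\<close>.\<close>

definition path_plsrd :: "nat \<Rightarrow> nat \<Rightarrow> int" where
  "path_plsrd n i = (if i mod 3 = 0 then -1 else if i mod 3 = 1 \<or> i + 2 = n then 2 else 1)"

text \<open>Three consecutive indices meet every residue modulo 3, so the values are -1, 2 and a
  positive one; this is (C3) at inner vertices.\<close>

lemma path_plsrd_add_3_ge: "path_plsrd n i + path_plsrd n (i + 1) + path_plsrd n (i + 2) \<ge> 1"
  by (cases i rule: nat_mod_3_cases) (simp_all add: path_plsrd_def mod_Suc)

lemma path_plsrd_eq_minus_1_iff: "path_plsrd n i = -1 \<longleftrightarrow> i mod 3 = 0"
  by (simp add: path_plsrd_def)

lemma path_plsrd_eq_2_iff: "path_plsrd n i = 2 \<longleftrightarrow> i mod 3 = 1 \<or> i mod 3 = 2 \<and> i + 2 = n"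
  using mod_less_divisor[of 3 i] by (auto simp: path_plsrd_def)

lemma plsrd_function_path_plsrd:
  assumes n: "n \<ge> 3"
  shows "plsrd_function (path_graph n) (path_plsrd n)"
  unfolding plsrd_function_def
proof (intro conjI ballI impI)
  fix v assume "v \<in> verts (path_graph n)"
  then have v: "v < n" by simp
  show "path_plsrd n v \<in> {-1, 1, 2}"
    by (simp add: path_plsrd_def)
  show "\<exists>!u. u \<in> verts (path_graph n) \<and> adj (path_graph n) v u \<and> path_plsrd n u = 2"
    if "path_plsrd n v = -1"
  proof (cases "v + 1 < n")
    case True
    have v3: "v mod 3 = 0"
      using that by (simp add: path_plsrd_eq_minus_1_iff)
    show ?thesis
    proof (rule ex1I[of _ "v + 1"])
      show "v + 1 \<in> verts (path_graph n) \<and> adj (path_graph n) v (v + 1) \<and>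
          path_plsrd n (v + 1) = 2"
        using True v3 by (simp add: adj_path_graph path_plsrd_eq_2_iff mod_Suc)
    next
      fix u assume u: "u \<in> verts (path_graph n) \<and> adj (path_graph n) v u \<and> path_plsrd n u = 2"
      then have "u mod 3 = 1 \<or> u mod 3 = 2 \<and> u + 2 = n"
        by (simp only: path_plsrd_eq_2_iff)
      \<comment> \<open>A left neighbor of \<open>v\<close> has residue 2, so it could have value 2
        only as vertex n - 2, which would make \<open>v\<close> the last vertex.\<close>
      then have "v \<noteq> u + 1"
        using v3 True by presburger
      then show "u = v + 1"
        using u by (simp add: adj_path_graph)
    qed
  next
    \<comment> \<open>Here \<open>v\<close> is the last vertex and its only neighbor is n - 2,
      raised to 2 by the exceptional disjunct.\<close>
    case False
    obtain w where w: "v = w + 1"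
      using False n v by (cases v) auto
    have w3: "w mod 3 = 2"
      using that w unfolding path_plsrd_eq_minus_1_iff by presburger
    show ?thesis
    proof (rule ex1I[of _ w])
      show "w \<in> verts (path_graph n) \<and> adj (path_graph n) v w \<and> path_plsrd n w = 2"
        using v w w3 False by (auto simp: adj_path_graph path_plsrd_eq_2_iff)
    next
      fix u assume "u \<in> verts (path_graph n) \<and> adj (path_graph n) v u \<and> path_plsrd n u = 2"
      then show "u = w"
        using w False by (auto simp: adj_path_graph)
    qed
  qed
  consider "v = 0" | "v = n - 1" "v \<noteq> 0" | w where "v = w + 1" "w + 2 < n"
    using v by (cases v) force+
  then show "sum (path_plsrd n) (closed_nbhd (path_graph n) v) \<ge> 1"
  proof cases
    case 1
    then show ?thesis
      using n by (simp add: closed_nbhd_path_graph path_plsrd_def)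
  next
    case 2
    obtain m where m: "n = m + 2"
      using n by (intro that[of "n - 2"]) simp
    \<comment> \<open>The residues 0, 1, 2 of \<open>m\<close> give -1 + 2, 2 + 1 and 2 - 1; the
      last case again relies on the exceptional value.\<close>
    then have "path_plsrd n m + path_plsrd n (m + 1) \<ge> 1"
      by (cases m rule: nat_mod_3_cases) (simp_all add: path_plsrd_def mod_Suc)
    then show ?thesis
      using 2 m by (simp add: closed_nbhd_path_graph)
  next
    case 3
    then show ?thesis
      using n path_plsrd_add_3_ge[of n w] by (simp add: closed_nbhd_path_graph)
  qed
next
  fix v w assume "v \<in> verts (path_graph n)" "w \<in> verts (path_graph n)"
    and vw: "v \<noteq> w \<and> path_plsrd n v = - 1 \<and> path_plsrd n w = - 1"
  \<comment> \<open>Distinct vertices of a path with a common neighbor differ by 2, which two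
    multiples of 3 never do.\<close>
  have "v \<noteq> w + 2" "w \<noteq> v + 2"
    using vw unfolding path_plsrd_eq_minus_1_iff by presburger+
  then show "\<not> (\<exists>u\<in>verts (path_graph n). adj (path_graph n) v u \<and> adj (path_graph n) w u \<and>
      path_plsrd n u = 2)"
    using vw by (auto simp: adj_path_graph)
qed

lemma weight_path_plsrd:
  assumes n: "n \<ge> 3"
  shows "weight (path_graph n) (path_plsrd n) = 2 * int n div 3"
proof -
  \<comment> \<open>The unadjusted pattern -1, 2, 1 falls one short of the target exactly when
    \<open>m mod 3 = 1\<close>; the exceptional value at n - 2 supplies that missing 1.\<close>
  have *: "(\<Sum>i<m. if i mod 3 = 0 then -1 else if i mod 3 = 1 then 2 else 1) =
      2 * int m div 3 - of_bool (m mod 3 = 1)" for m :: nat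
  proof (induction m)
    case (Suc m)
    then show ?case
      by (cases m rule: nat_mod_3_cases) (simp_all, presburger+)
  qed simp
  have "weight (path_graph n) (path_plsrd n) =
      (\<Sum>i<n. (if i mod 3 = 0 then -1 else if i mod 3 = 1 then 2 else 1) +
        (if i = n - 2 then of_bool (n mod 3 = 1) else 0))"
    unfolding weight_def verts_path_graph path_plsrd_def
  proof (rule sum.cong)
    fix i assume "i \<in> {..<n}"
    have "i = n - 2 \<longleftrightarrow> i + 2 = n"
      using n by auto
    moreover have "n mod 3 = 1 \<longleftrightarrow> i mod 3 = 2" if "i + 2 = n"
      using that by presburger
    moreover have "i mod 3 \<in> {0, 1, 2}"
      using mod_less_divisor[of 3 i] by auto
    ultimately show "(if i mod 3 = 0 then -1 else if i mod 3 = 1 \<or> i + 2 = n then 2 else 1) =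
        (if i mod 3 = 0 then -1 else if i mod 3 = 1 then 2 else 1) +
        (if i = n - 2 then of_bool (n mod 3 = 1) else 0 :: int)"
      by auto
  qed simp
  also have "\<dots> = 2 * int n div 3"
    using n by (simp add: sum.distrib *)
  finally show ?thesis .
qed

lemma plsrd_number_path_graph: "n \<ge> 3 \<Longrightarrow> plsrd_number (path_graph n) = 2 * int n div 3"
  by (intro plsrd_number_eqI[OF simple_graph_path_graph plsrd_function_path_plsrd]
      weight_path_plsrd plsrd_path_graph_weight_ge)

subsection \<open>Cycles\<close>

lemma verts_cycle_graph [simp]: "verts (cycle_graph n) = {..<n}"
  by (simp add: cycle_graph_def)

lemma adj_cycle_graph:
  assumes "u < n" "v < n"
  shows "adj (cycle_graph n) u v \<longleftrightarrow>
    v = (if u = n - 1 then 0 else u + 1) \<or> u = (if v = n - 1 then 0 else v + 1)"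
proof -
  have "adj (cycle_graph n) u v \<longleftrightarrow> v = (u + 1) mod n \<or> u = (v + 1) mod n"
    using assms unfolding adj_def cycle_graph_def by (auto simp: doubleton_eq_iff)
  moreover have "(i + 1) mod n = (if i = n - 1 then 0 else i + 1)" if "i < n" for i
    using that by auto
  ultimately show ?thesis
    using assms by presburger
qed

lemma closed_nbhd_cycle_graph:
  assumes "n \<ge> 3" "v < n"
  shows "closed_nbhd (cycle_graph n) v =
    {if v = 0 then n - 1 else v - 1, v, if v = n - 1 then 0 else v + 1}"
  using assms by (auto simp: closed_nbhd_def adj_cycle_graph split: if_splits)

lemma card_closed_nbhd_cycle_graph:
  "n \<ge> 3 \<Longrightarrow> v < n \<Longrightarrow> card (closed_nbhd (cycle_graph n) v) = 3"
  by (auto simp: closed_nbhd_cycle_graph card_insert_if)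

text \<open>All closed neighborhoods have exactly three elements, so |M| is at most
  \<open>n div 3\<close>. The bound is the ceiling of 2n/3 in integer form.\<close>

lemma plsrd_cycle_graph_weight_ge:
  assumes n: "n \<ge> 3" and f: "plsrd_function (cycle_graph n) f"
  shows "weight (cycle_graph n) f \<ge> int n - int n div 3"
proof -
  have "3 * card {v \<in> verts (cycle_graph n). f v = -1} \<le> n"
    using plsrd_sum_card_closed_nbhd_le[OF simple_graph_cycle_graph[OF n] f] n
    by (simp add: card_closed_nbhd_cycle_graph)
  then show ?thesis
    using plsrd_weight_ge[OF simple_graph_cycle_graph[OF n] f] by simp
qed

text \<open>The pattern fills only the \<open>n div 3\<close> complete blocks; the at most two
  leftover vertices get 1, which keeps the values across the wrap-around edge compatible.\<close>

definition cycle_plsrd :: "nat \<Rightarrow> nat \<Rightarrow> int" where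
  "cycle_plsrd n i =
    (if i \<ge> 3 * (n div 3) \<or> i mod 3 = 2 then 1 else if i mod 3 = 0 then -1 else 2)"

lemma cycle_plsrd_eq_minus_1_iff:
  "cycle_plsrd n i = -1 \<longleftrightarrow> i mod 3 = 0 \<and> i < 3 * (n div 3)"
  by (auto simp: cycle_plsrd_def)

lemma cycle_plsrd_eq_2_iff: "cycle_plsrd n i = 2 \<longleftrightarrow> i mod 3 = 1 \<and> i < 3 * (n div 3)"
  using mod_less_divisor[of 3 i] by (auto simp: cycle_plsrd_def)

text \<open>At most one of three consecutive indices is divisible by 3, and all values other than -1
  are at least 1.\<close>

lemma cycle_plsrd_add_3_ge: "cycle_plsrd n i + cycle_plsrd n (i + 1) + cycle_plsrd n (i + 2) \<ge> 1"
  by (cases i rule: nat_mod_3_cases) (auto simp: cycle_plsrd_def mod_Suc)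

text \<open>The last index has residue 2 if 3 divides n and is a leftover vertex otherwise. Hence
  the wrap-around edge never joins a -1 to a 2.\<close>

lemma cycle_plsrd_last:
  assumes "n \<ge> 3"
  shows "cycle_plsrd n (n - 1) = 1"
proof -
  obtain m where "n = m + 1"
    using assms by (intro that[of "n - 1"]) simp
  then show ?thesis
    by (cases m rule: nat_mod_3_cases) (simp_all add: cycle_plsrd_def, presburger+)
qed

lemma plsrd_function_cycle_plsrd:
  assumes n: "n \<ge> 3"
  shows "plsrd_function (cycle_graph n) (cycle_plsrd n)"
proof -
  have first: "cycle_plsrd n 0 = -1" "cycle_plsrd n 1 = 2"
    using n unfolding cycle_plsrd_eq_minus_1_iff cycle_plsrd_eq_2_iff by presburger+
  \<comment> \<open>Only the successor of a -1 can be a neighbor of value 2. This yields both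
    uniqueness in (C1) and all of (C2).\<close>
  have nbr: "u = v + 1"
    if "u < n" "v < n" "adj (cycle_graph n) v u" "cycle_plsrd n v = -1" "cycle_plsrd n u = 2" for u v
  proof -
    have "v mod 3 = 0" "u mod 3 = 1"
      using that by (simp_all only: cycle_plsrd_eq_minus_1_iff cycle_plsrd_eq_2_iff)
    then have "v \<noteq> u + 1"
      by presburger
    moreover have "u \<noteq> n - 1" "v \<noteq> n - 1"
      using that cycle_plsrd_last[OF n] by auto
    ultimately show ?thesis
      using that by (simp add: adj_cycle_graph)
  qed
  show ?thesis
    unfolding plsrd_function_def
  proof (intro conjI ballI impI)
    fix v assume "v \<in> verts (cycle_graph n)"
    then have v: "v < n" by simp
    show "cycle_plsrd n v \<in> {-1, 1, 2}"
      by (simp add: cycle_plsrd_def)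
    show "\<exists>!u. u \<in> verts (cycle_graph n) \<and> adj (cycle_graph n) v u \<and> cycle_plsrd n u = 2"
      if v1: "cycle_plsrd n v = -1"
    proof (rule ex1I[of _ "v + 1"])
      obtain k where "v = 3 * k" "k < n div 3"
        using v1 by (auto simp: cycle_plsrd_eq_minus_1_iff)
      then have "cycle_plsrd n (v + 1) = 2"
        by (simp add: cycle_plsrd_eq_2_iff)
      moreover have "v \<noteq> n - 1"
        using v1 cycle_plsrd_last[OF n] by auto
      ultimately show "v + 1 \<in> verts (cycle_graph n) \<and> adj (cycle_graph n) v (v + 1) \<and>
          cycle_plsrd n (v + 1) = 2"
        using v by (simp add: adj_cycle_graph)
    qed (use nbr v v1 in auto)
    consider "v = 0" | "v = n - 1" "v \<noteq> 0" | w where "v = w + 1" "w + 2 < n"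
      using v by (cases v) force+
    then show "sum (cycle_plsrd n) (closed_nbhd (cycle_graph n) v) \<ge> 1"
    proof cases
      case 1
      then show ?thesis
        using n first cycle_plsrd_last[OF n] by (simp add: closed_nbhd_cycle_graph)
    next
      case 2
      \<comment> \<open>If 3 divides n - 2, then n - 2 is the first leftover vertex. The
        neighborhood of n - 1 thus sums to at least 1 + 1 - 1.\<close>
      have "cycle_plsrd n (n - 2) \<noteq> -1"
        using n unfolding cycle_plsrd_eq_minus_1_iff by presburger
      then have "cycle_plsrd n (n - 2) \<ge> 1"
        by (auto simp: cycle_plsrd_def split: if_splits)
      moreover have "n - 1 - 1 = n - 2" by simp
      ultimately show ?thesis
        using 2 n first cycle_plsrd_last[OF n] by (simp add: closed_nbhd_cycle_graph)
    next
      case 3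
      then show ?thesis
        using n cycle_plsrd_add_3_ge[of n w] by (simp add: closed_nbhd_cycle_graph)
    qed
  next
    fix v w assume "v \<in> verts (cycle_graph n)" "w \<in> verts (cycle_graph n)"
      "v \<noteq> w \<and> cycle_plsrd n v = - 1 \<and> cycle_plsrd n w = - 1"
    \<comment> \<open>A common neighbor of value 2 would be both v + 1 and w + 1.\<close>
    then show "\<not> (\<exists>u\<in>verts (cycle_graph n). adj (cycle_graph n) v u \<and> adj (cycle_graph n) w u \<and>
        cycle_plsrd n u = 2)"
      using nbr[of _ v] nbr[of _ w] by (metis add_right_cancel lessThan_iff verts_cycle_graph)
  qed
qed

lemma weight_cycle_plsrd: "weight (cycle_graph n) (cycle_plsrd n) = int n - int n div 3"
proof -
  \<comment> \<open>Each complete block weighs -1 + 2 + 1 = 2. With q = \<open>n div 3\<close>, the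
    leftover vertices add n - 3q, for a total of n - q.\<close>
  have *: "sum (cycle_plsrd n) {..<3 * k} = 2 * int k" if "k \<le> n div 3" for k
    using that
  proof (induction k)
    case (Suc k)
    have "{..<3 * Suc k} = insert (3 * k + 2) (insert (3 * k + 1) (insert (3 * k) {..<3 * k}))"
      by auto
    with Suc show ?case
      by (simp add: cycle_plsrd_def) presburger
  qed simp
  have "{..<n} = {..<3 * (n div 3)} \<union> {3 * (n div 3)..<n}"
    by auto
  then have "sum (cycle_plsrd n) {..<n} =
      sum (cycle_plsrd n) {..<3 * (n div 3)} + sum (cycle_plsrd n) {3 * (n div 3)..<n}"
    by (simp add: sum.union_disjoint ivl_disj_int)
  also have "sum (cycle_plsrd n) {3 * (n div 3)..<n} = int (n - 3 * (n div 3))"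
    by (simp add: cycle_plsrd_def)
  finally show ?thesis
    using * by (simp add: weight_def)
qed

lemma plsrd_number_cycle_graph:
  "n \<ge> 3 \<Longrightarrow> plsrd_number (cycle_graph n) = int n - int n div 3"
  by (intro plsrd_number_eqI[OF simple_graph_cycle_graph plsrd_function_cycle_plsrd]
      weight_cycle_plsrd plsrd_cycle_graph_weight_ge)

theorem theorem2:
  fixes n :: nat
  assumes "n \<ge> 3"
  shows "plsrd_number (path_graph n) = \<lfloor>2 * real n / 3\<rfloor>
       \<and> plsrd_number (cycle_graph n) = \<lceil>2 * real n / 3\<rceil>"
proof -
  have "\<lfloor>2 * real n / 3\<rfloor> = 2 * int n div 3"
    using floor_divide_of_int_eq[of "2 * int n" 3] by simp
  \<comment> \<open>The ceiling becomes \<open>- (- (2 * int n) div 3)\<close>, and -2n = n - 3n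
    turns this into the stated form.\<close>
  moreover have "\<lceil>2 * real n / 3\<rceil> = int n - int n div 3"
    using ceiling_divide_eq_div[where 'a = real, of "2 * int n" 3] by simp
  ultimately show ?thesis
    using assms by (simp add: plsrd_number_path_graph plsrd_number_cycle_graph)
qed

end
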